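(* Let $M$ be a set system on $[n]$. Then $M$ is a strong $\Delta$-matroid if and only if $\nu_M$ satisfies the peerless antipode equations $\mathcal G_n$ (i.e. satisfies every tropical equation in $\mathcal G_n$).
   Context: A set system on $[n]=\{1,\dots,n\}$ is a (possibly empty) collection of subsets of $[n]$; $\triangle$ is symmetric difference (when $a=b$, $\{a,b\}=\{a\}$). A $\Delta$-matroid is a set system $M$ such that for all $A,B\in M$ and $a\in A\triangle B$ there exists $b\in A\triangle B$ (possibly $b=a$) with $A\triangle\{a,b\}\in M$. A $\Delta$-matroid $M$ is strong if for all distinct $A,B\in M$ there exist (possibly equal) $a,b\in A\triangle B$ such that $A\triangle\{a,b\}\in M$ and $B\triangle\{a,b\}\in M$. Let $X=\{x_S:S\subseteq[n]\}$ be indeterminates and $\mathbb B=\{0,1\}$ the Boolean semifield ($1\oplus1=1$). A tropical equation is a formal sum $f=\bigoplus_{a\in A}X^{\odot a}$ with $A\subset\mathbb N^X$ finite (determined by the set $A$ of its monomials). It is satisfied by $p\in\mathbb B^X$ if the number of $a\in A$ such that $p(x_S)=1$ for all $x_S$ with $a(x_S)>0$ is not exactly $1$. For a set system $M$ on $[n]$, $\nu_M\in\mathbb B^X$ is defined by $\nu_M(x_S)=1$ iff $S\in M$. For $I,J\subseteq[n]$, the antipodes of the cube $\square_{I,J}=\operatorname{conv}\{\varepsilon_S: I\cap J\subseteq S\subseteq I\cup J\}$ ($\varepsilon_S\in\mathbb R^n$ the indicator vector of $S$) are the pairs $(\varepsilon_S,\varepsilon_T)$ with $S\cap T=I\cap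 J$ and $S\triangle T=I\triangle J$. Put $g_{I,J}=\bigoplus x_S\odot x_T$, the sum over all antipodes of $\square_{I,J}$ (each unordered pair $\{S,T\}$ contributing one monomial). The peerless antipode equations are $\mathcal G_n=\{g_{I,J}: I,J\subseteq[n],\ |I\triangle J|\ge3\}$. *)

theory Defs
  imports Main "HOL-Library.Poly_Mapping"
begin

definition set_system :: "nat \<Rightarrow> nat set set \<Rightarrow> bool" where
  "set_system n M \<longleftrightarrow> M \<subseteq> Pow {1..n}"

definition delta_matroid :: "nat \<Rightarrow> nat set set \<Rightarrow> bool" where
  "delta_matroid n M \<longleftrightarrow> set_system n M \<and>
     (\<forall>A\<in>M. \<forall>B\<in>M. \<forall>a\<in>sym_diff A B. \<exists>b\<in>sym_diff A B. sym_diff A {a, b} \<in> M)"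

definition strong_delta_matroid :: "nat \<Rightarrow> nat set set \<Rightarrow> bool" where
  "strong_delta_matroid n M \<longleftrightarrow> delta_matroid n M \<and>
     (\<forall>A\<in>M. \<forall>B\<in>M. A \<noteq> B \<longrightarrow>
        (\<exists>a\<in>sym_diff A B. \<exists>b\<in>sym_diff A B.
           sym_diff A {a, b} \<in> M \<and> sym_diff B {a, b} \<in> M))"

text \<open>
  A monomial in indeterminates of type \<^typ>\<open>'x\<close> is its exponent vector, and the tropical
  product of monomials is the sum of exponent vectors. A tropical equation is identified with its
  set of monomials; finiteness of that set is not part of the type, but is proved below for
  the equations considered here. The Boolean semifield is \<^typ>\<open>bool\<close>, with
  \<^term>\<open>False\<close> as 0, \<^term>\<open>True\<close> as 1 and disjunction as addition.
\<close>

type_synonym 'x monomial = "'x \<Rightarrow>\<^sub>0 nat"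
type_synonym 'x tropical_equation = "'x monomial set"

definition indet :: "'x \<Rightarrow> 'x monomial" where
  "indet x = Poly_Mapping.single x 1"

definition satisfies :: "('x \<Rightarrow> bool) \<Rightarrow> 'x tropical_equation \<Rightarrow> bool" where
  "satisfies p f \<longleftrightarrow>
     card {a \<in> f. \<forall>x. Poly_Mapping.lookup a x > 0 \<longrightarrow> p x} \<noteq> 1"

text \<open>
  The indeterminate \<open>x\<^sub>S\<close> is indexed by the set \<open>S\<close> itself.
\<close>

definition nu :: "nat set set \<Rightarrow> nat set \<Rightarrow> bool" where
  "nu M S \<longleftrightarrow> S \<in> M"

text \<open>
  A vertex \<open>\<epsilon>\<^sub>S\<close> of the cube is identified with \<open>S\<close>. The two conditions force
  \<open>I \<inter> J \<subseteq> S, T \<subseteq> I \<union> J\<close>. The pairs here are ordered; since the two orderings of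
  an antipodal pair give the same monomial, each unordered pair contributes one element to
  \<open>antipode_equation I J\<close>.
\<close>

definition antipodes :: "nat set \<Rightarrow> nat set \<Rightarrow> (nat set \<times> nat set) set" where
  "antipodes I J = {(S, T). S \<inter> T = I \<inter> J \<and> sym_diff S T = sym_diff I J}"

definition antipode_equation :: "nat set \<Rightarrow> nat set \<Rightarrow> nat set tropical_equation" where
  "antipode_equation I J = {indet S + indet T | S T. (S, T) \<in> antipodes I J}"

definition peerless_antipode_equations :: "nat \<Rightarrow> nat set tropical_equation set" where
  "peerless_antipode_equations n =
     {antipode_equation I J | I J. I \<subseteq> {1..n} \<and> J \<subseteq> {1..n} \<and> card (sym_diff I J) \<ge> 3}"

lemma antipodes_subset: "antipodes I J \<subseteq> Pow (I \<union> J) \<times> Pow (I \<union> J)"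
  unfolding antipodes_def by blast

lemma peerless_antipode_equations_finite:
  assumes "f \<in> peerless_antipode_equations n"
  shows "finite f"
proof -
  obtain I J where f: "f = antipode_equation I J" and "I \<subseteq> {1..n}" "J \<subseteq> {1..n}"
    using assms unfolding peerless_antipode_equations_def by blast
  then have "finite (Pow (I \<union> J) \<times> Pow (I \<union> J))"
    by (meson finite_Pow_iff finite_SigmaI finite_UnI finite_atLeastAtMost finite_subset)
  then have "finite (antipodes I J)"
    using antipodes_subset finite_subset by blast
  moreover have "f = (\<lambda>(S, T). indet S + indet T) ` antipodes I J"
    unfolding f antipode_equation_def by auto
  ultimately show ?thesis by simp
qed

lemma peerless_antipode_equations_indets:
  assumes "f \<in> peerless_antipode_equations n" "a \<in> f"
  shows "Poly_Mapping.keys a \<subseteq> Pow {1..n}"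
proof -
  obtain I J where f: "f = antipode_equation I J" and IJ: "I \<subseteq> {1..n}" "J \<subseteq> {1..n}"
    using assms(1) unfolding peerless_antipode_equations_def by blast
  obtain S T where a: "a = indet S + indet T" and ST: "(S, T) \<in> antipodes I J"
    using assms(2) unfolding f antipode_equation_def by blast
  have "Poly_Mapping.keys a \<subseteq> {S, T}"
    using keys_add[of "indet S" "indet T"] unfolding a indet_def by auto
  then show ?thesis using ST antipodes_subset[of I J] IJ by blast
qed

end

theory Submission
  imports Defs
begin

text \<open>
  The equation \<open>g\<^sub>I\<^sub>J\<close> holds iff no antipodal pair of the cube is the only one inside \<open>M\<close>; strong
  exchange produces a second pair, which settles one direction. For the other, make \<open>M\<close> even by
  adjoining the new element 0 to its members of odd size. Peerlessness of \<open>M\<close> implies, by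
  induction on the distance of two members, that this parity lift is an even \<open>\<Delta>\<close>-matroid. Even
  \<open>\<Delta>\<close>-matroids satisfy simultaneous exchange by a theorem of Wenzel, and simultaneous exchange in
  the lift projects to strong exchange in \<open>M\<close>.
\<close>

section \<open>Simultaneous exchange in even \<open>\<Delta>\<close>-matroids\<close>

text \<open>Requiring \<open>b \<noteq> a\<close> forces all finite distances between members to be even.\<close>

definition even_exchange :: "'a set set \<Rightarrow> bool" where
  "even_exchange M \<longleftrightarrow>
     (\<forall>A\<in>M. \<forall>B\<in>M. \<forall>a\<in>sym_diff A B. \<exists>b\<in>sym_diff A B. b \<noteq> a \<and> sym_diff A {a, b} \<in> M)"

lemma even_exchangeE:
  assumes "even_exchange M" "A \<in> M" "B \<in> M" "a \<in> sym_diff A B"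
  obtains b where "b \<in> sym_diff A B" "b \<noteq> a" "sym_diff A {a, b} \<in> M"
  using assms unfolding even_exchange_def by blast

lemma sym_diff_assoc: "sym_diff (sym_diff A B) C = sym_diff A (sym_diff B C)"
  by blast

text \<open>Twisting two members by the same \<open>C\<close> leaves their difference unchanged.
  This allows a chosen member to be moved to the empty set.\<close>

lemma even_exchange_twist:
  assumes "even_exchange M"
  shows "even_exchange {X. sym_diff C X \<in> M}"
  unfolding even_exchange_def
proof (intro ballI)
  fix A B a
  assume A: "A \<in> {X. sym_diff C X \<in> M}" and B: "B \<in> {X. sym_diff C X \<in> M}"
    and a: "a \<in> sym_diff A B"
  have eq: "sym_diff (sym_diff C A) (sym_diff C B) = sym_diff A B"
    by blast
  obtain b where "b \<in> sym_diff A B" "b \<noteq> a" "sym_diff (sym_diff C A) {a, b} \<in> M"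
    using even_exchangeE[OF assms, of "sym_diff C A" "sym_diff C B" a] A B a
    unfolding eq by blast
  then show "\<exists>b\<in>sym_diff A B. b \<noteq> a \<and> sym_diff A {a, b} \<in> {X. sym_diff C X \<in> M}"
    unfolding sym_diff_assoc by blast
qed

text \<open>
  Every element of the cube lies in some 2-subset belonging to \<open>M\<close> and is avoided by another one.
  A choice of at most one 2-subset from each complementary pair is contained in a star or in a
  triangle, which cannot do both.
\<close>

lemma even_exchange_cube4:
  assumes M: "even_exchange M" and M0: "{} \<in> M" and M4: "{a, b, c, d} \<in> M"
    and dist: "distinct [a, b, c, d]"
  shows "{a, b} \<in> M \<and> {c, d} \<in> M \<or> {a, c} \<in> M \<and> {b, d} \<in> M \<or> {a, d} \<in> M \<and> {b, c} \<in> M"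
proof -
  have up: "\<exists>y\<in>{a, b, c, d}. y \<noteq> x \<and> {x, y} \<in> M" if "x \<in> {a, b, c, d}" for x
    using even_exchangeE[OF M M0 M4, of x] that by auto
  have down: "\<exists>y\<in>{a, b, c, d}. y \<noteq> x \<and> {a, b, c, d} - {x, y} \<in> M" if x: "x \<in> {a, b, c, d}" for x
  proof -
    obtain y where y: "y \<in> {a, b, c, d}" "y \<noteq> x" "sym_diff {a, b, c, d} {x, y} \<in> M"
      using even_exchangeE[OF M M4 M0, of x] x by auto
    then have "sym_diff {a, b, c, d} {x, y} = {a, b, c, d} - {x, y}"
      using x by blast
    then have "{a, b, c, d} - {x, y} \<in> M"
      using y(3) by (simp only:)
    then show ?thesis using y(1,2) by (intro bexI conjI)
  qed
  have up': "{a, b} \<in> M \<or> {a, c} \<in> M \<or> {a, d} \<in> M" "{a, b} \<in> M \<or> {b, c} \<in> M \<or> {b, d} \<in> M"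
    "{a, c} \<in> M \<or> {b, c} \<in> M \<or> {c, d} \<in> M" "{a, d} \<in> M \<or> {b, d} \<in> M \<or> {c, d} \<in> M"
    using up[of a] up[of b] up[of c] up[of d] by (auto simp: insert_commute)
  have compl: "{a, b, c, d} - {a, b} = {c, d}" "{a, b, c, d} - {a, c} = {b, d}"
    "{a, b, c, d} - {a, d} = {b, c}" "{a, b, c, d} - {b, c} = {a, d}"
    "{a, b, c, d} - {b, d} = {a, c}" "{a, b, c, d} - {c, d} = {a, b}"
    using dist by auto
  have comm: "{b, a} = {a, b}" "{c, a} = {a, c}" "{d, a} = {a, d}" "{c, b} = {b, c}"
    "{d, b} = {b, d}" "{d, c} = {c, d}"
    by auto
  have down': "{c, d} \<in> M \<or> {b, d} \<in> M \<or> {b, c} \<in> M" "{c, d} \<in> M \<or> {a, d} \<in> M \<or> {a, c} \<in> M"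
    "{b, d} \<in> M \<or> {a, d} \<in> M \<or> {a, b} \<in> M" "{b, c} \<in> M \<or> {a, c} \<in> M \<or> {a, b} \<in> M"
    using down[of a] down[of b] down[of c] down[of d]
    by (simp_all only: bex_simps compl comm insert_iff simp_thms) blast+
  show ?thesis using up' down' by argo
qed

text \<open>Wenzel's theorem with one member at the origin. In a smallest counterexample
  \<open>D\<close>, removing a pair that avoids \<open>a\<close> gives a smaller member; induction
  there and the 4-cube below \<open>D\<close> leave few options, and two rounds exhaust
  them.\<close>

lemma even_exchange_simultaneous_origin:
  assumes M: "even_exchange M" and M0: "{} \<in> M" and "D \<in> M" "finite D" "a \<in> D"
  shows "\<exists>b\<in>D. b \<noteq> a \<and> {a, b} \<in> M \<and> D - {a, b} \<in> M"
  using assms(3-5)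
proof (induction "card D" arbitrary: D rule: less_induct)
  case less
  show ?case
  proof (rule ccontr)
    assume "\<not> ?case"
    then have no: "D - {a, b} \<notin> M" if "b \<in> D" "b \<noteq> a" "{a, b} \<in> M" for b
      using that by blast
    \<comment> \<open>Induction for \<open>D - {c, d}\<close> gives \<open>b\<close> with
      \<open>D - {a, b, c, d}\<close> in \<open>M\<close>. The 4-cube lemma, read downwards from
      \<open>D\<close>, offers three complementary pairs, and \<open>no\<close> rules out the one
      containing \<open>D - {a, b}\<close>.\<close>
    have key: "\<exists>b\<in>D - {a, c, d}. {a, b} \<in> M \<and>
        (D - {a, c} \<in> M \<or> D - {a, d} \<in> M \<and> D - {b, c} \<in> M)"
      if cd: "c \<in> D" "d \<in> D" "c \<noteq> a" "d \<noteq> a" "c \<noteq> d" "D - {c, d} \<in> M" for c d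
    proof -
      have "card (D - {c, d}) < card D"
        using cd less.prems by (intro psubset_card_mono) auto
      then obtain b where b: "b \<in> D - {c, d}" "b \<noteq> a" "{a, b} \<in> M" "D - {c, d} - {a, b} \<in> M"
        using less.hyps[of "D - {c, d}"] cd less.prems by blast
      have flip: "sym_diff D X = D - X" if "X \<subseteq> D" for X
        using that by blast
      have "sym_diff D {a, b, c, d} = D - {c, d} - {a, b}"
        using b(1) cd(1,2) less.prems(3) by blast
      then have "{a, b, c, d} \<in> {X. sym_diff D X \<in> M}"
        using b(4) by simp
      then have "D - {a, b} \<in> M \<and> D - {c, d} \<in> M \<or> D - {a, c} \<in> M \<and> D - {b, d} \<in> M
          \<or> D - {a, d} \<in> M \<and> D - {b, c} \<in> M"
        using even_exchange_cube4[OF even_exchange_twist[OF M, of D], of a b c d] b cd less.prems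
        by (auto simp: flip)
      then show ?thesis using b no[of b] by blast
    qed
    \<comment> \<open>Since \<open>{a, c}\<close> is a member, \<open>no\<close> excludes
      \<open>D - {a, c}\<close>. This forces \<open>d \<noteq> a\<close> below and selects the
      second alternative of \<open>key\<close>.\<close>
    obtain c where c: "c \<in> D" "c \<noteq> a" "{a, c} \<in> M"
      using even_exchangeE[OF M M0 less.prems(1), of a] less.prems(3) by auto
    obtain d where d: "d \<in> D" "d \<noteq> c" "sym_diff D {c, d} \<in> M"
      using even_exchangeE[OF M less.prems(1) M0, of c] c by auto
    have "sym_diff D {c, d} = D - {c, d}"
      using c d by blast
    then have dM: "D - {c, d} \<in> M"
      using d by simp
    then have "d \<noteq> a"
      using no[OF c] by (auto simp: insert_commute)
    then obtain b where b: "b \<in> D - {a, c, d}" "{a, b} \<in> M" "D - {b, c} \<in> M"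
      using key[of c d] c d dM no[OF c] by blast
    \<comment> \<open>With \<open>b, c\<close> in place of \<open>c, d\<close>, \<open>key\<close>
      puts \<open>D - {a, b}\<close> or \<open>D - {a, c}\<close> into \<open>M\<close>; both are
      excluded, as \<open>{a, b}\<close> and \<open>{a, c}\<close> are members.\<close>
    then show False
      using key[of b c] c no[of b] no[of c] by blast
  qed
qed

text \<open>Twisting by \<open>A\<close> sends \<open>A\<close> to the empty set and
  \<open>B\<close> to \<open>sym_diff A B\<close>, which reduces to the case of the origin.\<close>

lemma even_exchange_simultaneous:
  assumes M: "even_exchange M" and A: "A \<in> M" and B: "B \<in> M"
    and fin: "finite (sym_diff A B)" and a: "a \<in> sym_diff A B"
  shows "\<exists>b\<in>sym_diff A B. b \<noteq> a \<and> sym_diff A {a, b} \<in> M \<and> sym_diff B {a, b} \<in> M"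
proof -
  have "sym_diff A (sym_diff A B) = B"
    by blast
  then obtain b where b: "b \<in> sym_diff A B" "b \<noteq> a" "sym_diff A {a, b} \<in> M"
      "sym_diff A (sym_diff A B - {a, b}) \<in> M"
    using even_exchange_simultaneous_origin[OF even_exchange_twist[OF M, of A] _ _ fin a] A B
    by auto
  moreover have "sym_diff A (sym_diff A B - {a, b}) = sym_diff B {a, b}"
    using a b(1) by blast
  ultimately show ?thesis by auto
qed

section \<open>Peerless set systems\<close>

text \<open>The combinatorial content of the antipode equations. An antipode is determined by its
  partner, so \<open>S\<close> differing from \<open>A\<close> and \<open>B\<close> makes the pair
  \<open>S, T\<close> a new one.\<close>

definition peerless :: "'a set set \<Rightarrow> bool" where
  "peerless M \<longleftrightarrow> (\<forall>A\<in>M. \<forall>B\<in>M. card (sym_diff A B) \<ge> 3 \<longrightarrow>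
     (\<exists>S\<in>M. \<exists>T\<in>M. S \<inter> T = A \<inter> B \<and> sym_diff S T = sym_diff A B \<and> S \<noteq> A \<and> S \<noteq> B))"

text \<open>The second antipodal pair splits the difference of \<open>A\<close> and \<open>B\<close>
  into two disjoint nonempty parts, so \<open>S\<close> and \<open>T\<close> are both nearer to
  \<open>A\<close> than \<open>B\<close> is. This drives inductions that keep \<open>A\<close>
  fixed.\<close>

lemma peerlessE:
  assumes "peerless M" "A \<in> M" "B \<in> M" "card (sym_diff A B) \<ge> 3"
  obtains S T where "S \<in> M" "T \<in> M" "sym_diff A B = sym_diff A S \<union> sym_diff A T"
    "card (sym_diff A B) = card (sym_diff A S) + card (sym_diff A T)"
    "card (sym_diff A S) < card (sym_diff A B)" "card (sym_diff A T) < card (sym_diff A B)"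
proof -
  obtain S T where ST: "S \<in> M" "T \<in> M" "S \<inter> T = A \<inter> B" "sym_diff S T = sym_diff A B"
      "S \<noteq> A" "S \<noteq> B"
    using assms(1)[unfolded peerless_def, rule_format, OF assms(2-4)] by (elim bexE conjE) (rule that)
  have pt: "x \<in> S \<and> x \<in> T \<longleftrightarrow> x \<in> A \<and> x \<in> B" "x \<in> sym_diff S T \<longleftrightarrow> x \<in> sym_diff A B" for x
    using eqset_imp_iff[OF ST(3), of x] eqset_imp_iff[OF ST(4), of x] by simp_all
  have un: "sym_diff A B = sym_diff A S \<union> sym_diff A T"
    by (rule set_eqI) (use pt in auto)
  have disj: "sym_diff A S \<inter> sym_diff A T = {}"
    using pt by auto
  \<comment> \<open>An infinite set has cardinality 0, so the lower bound 3 implies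
    finiteness.\<close>
  have fin: "finite (sym_diff A B)"
    using assms(4) by (metis card.infinite not_numeral_le_zero)
  then have fins: "finite (sym_diff A S)" "finite (sym_diff A T)"
    unfolding un by auto
  have card: "card (sym_diff A B) = card (sym_diff A S) + card (sym_diff A T)"
    unfolding un by (rule card_Un_disjoint[OF fins disj])
  have "sym_diff A S \<noteq> {}"
    using ST(5) by blast
  moreover have "sym_diff A T \<noteq> {}"
  proof
    assume "sym_diff A T = {}"
    then have "T = A" by blast
    then have "S = B" using pt by blast
    then show False using ST(6) by simp
  qed
  ultimately have "card (sym_diff A S) > 0" "card (sym_diff A T) > 0"
    using fins card_gt_0_iff by blast+
  with that[OF ST(1,2) un card] card show ?thesis by linarith
qed

text \<open>One of the nearer members \<open>S\<close>, \<open>T\<close> still differs from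
  \<open>A\<close> at \<open>a\<close>, and a partner found towards it also serves for
  \<open>B\<close>. At distance at most 2, flipping the whole difference yields \<open>B\<close>
  itself.\<close>

lemma peerless_exchange:
  assumes M: "peerless M" and A: "A \<in> M" and "B \<in> M" "finite (sym_diff A B)" "a \<in> sym_diff A B"
  shows "\<exists>b\<in>sym_diff A B. sym_diff A {a, b} \<in> M"
  using assms(3-5)
proof (induction "card (sym_diff A B)" arbitrary: B rule: less_induct)
  case less
  show ?case
  proof (cases "card (sym_diff A B) \<ge> 3")
    case True
    obtain S T where ST: "S \<in> M" "T \<in> M" "sym_diff A B = sym_diff A S \<union> sym_diff A T"
        "card (sym_diff A S) < card (sym_diff A B)" "card (sym_diff A T) < card (sym_diff A B)"
      using peerlessE[OF M A less.prems(1) True] by metis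
    have "finite (sym_diff A S)" "finite (sym_diff A T)"
      using less.prems(2) unfolding ST(3) by auto
    moreover have "a \<in> sym_diff A S \<or> a \<in> sym_diff A T"
      using less.prems(3) unfolding ST(3) by blast
    ultimately have "(\<exists>b\<in>sym_diff A S. sym_diff A {a, b} \<in> M) \<or> (\<exists>b\<in>sym_diff A T. sym_diff A {a, b} \<in> M)"
      using less.hyps[OF ST(4,1)] less.hyps[OF ST(5,2)] by blast
    then show ?thesis unfolding ST(3) by blast
  next
    case False
    have "card (sym_diff A B - {a}) \<le> 1"
      using False less.prems(2,3) by (subst card_Diff_singleton) auto
    then obtain b where "sym_diff A B - {a} \<subseteq> {b}"
      using less.prems(2) by (metis card_le_Suc0_iff_eq One_nat_def finite_Diff singleton_iff subsetI)
    then have "\<exists>b\<in>sym_diff A B. sym_diff A B = {a, b}"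
      using less.prems(3) by blast
    then obtain b where b: "b \<in> sym_diff A B" "sym_diff A B = {a, b}" by blast
    have "sym_diff A (sym_diff A B) = B" by blast
    then show ?thesis using b less.prems(1) by metis
  qed
qed

text \<open>An odd distance splits into an odd and an even one, so the induction can follow the odd
  part down to distance 1.\<close>

lemma peerless_odd_exchange:
  assumes M: "peerless M" and A: "A \<in> M" and "B \<in> M" "odd (card (sym_diff A B))"
  shows "\<exists>b\<in>sym_diff A B. sym_diff A {b} \<in> M"
  using assms(3-4)
proof (induction "card (sym_diff A B)" arbitrary: B rule: less_induct)
  case less
  show ?case
  proof (cases "card (sym_diff A B) \<ge> 3")
    case True
    obtain S T where ST: "S \<in> M" "T \<in> M" "sym_diff A B = sym_diff A S \<union> sym_diff A T"
        "card (sym_diff A B) = card (sym_diff A S) + card (sym_diff A T)"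
        "card (sym_diff A S) < card (sym_diff A B)" "card (sym_diff A T) < card (sym_diff A B)"
      using peerlessE[OF M A less.prems(1) True] by metis
    have "odd (card (sym_diff A S)) \<or> odd (card (sym_diff A T))"
      using less.prems(2) unfolding ST(4) by auto
    then have "(\<exists>b\<in>sym_diff A S. sym_diff A {b} \<in> M) \<or> (\<exists>b\<in>sym_diff A T. sym_diff A {b} \<in> M)"
      using less.hyps[OF ST(5,1)] less.hyps[OF ST(6,2)] by blast
    then show ?thesis unfolding ST(3) by blast
  next
    case False
    then have "card (sym_diff A B) = 1"
      using less.prems(2) by (cases "card (sym_diff A B)")
        (auto simp: numeral_3_eq_3 le_Suc_eq not_le less_Suc_eq)
    then obtain b where b: "sym_diff A B = {b}"
      using card_1_singletonE by blast
    have "sym_diff A (sym_diff A B) = B" by blast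
    then show ?thesis using b less.prems(1) by (metis singletonI)
  qed
qed

section \<open>The parity lift\<close>

text \<open>For \<open>M\<close> on \<open>{1..n}\<close> the element 0 is new, and each member
  \<open>X\<close> has exactly one lift, \<open>X\<close> or \<open>insert 0 X\<close>.\<close>

definition parity_lift :: "nat set set \<Rightarrow> nat set set" where
  "parity_lift M = {T. even (card T) \<and> T - {0} \<in> M}"

lemma even_card_sym_diff:
  assumes "finite A" "finite B"
  shows "even (card (sym_diff A B)) \<longleftrightarrow> (even (card A) \<longleftrightarrow> even (card B))"
proof -
  have "card A = card (A - B) + card (A \<inter> B)" "card B = card (B - A) + card (A \<inter> B)"
    using assms by (subst card_Un_disjoint[symmetric]; auto intro: arg_cong[where f = card])+
  moreover have "card (sym_diff A B) = card (A - B) + card (B - A)"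
    using assms by (intro card_Un_disjoint) auto
  ultimately show ?thesis by auto
qed

text \<open>Flipping two distinct elements preserves parity, so only the trace away from 0 has to be
  checked.\<close>

lemma parity_lift_flip:
  assumes "A \<in> parity_lift M" "finite A" "a \<noteq> b" "sym_diff (A - {0}) ({a, b} - {0}) \<in> M"
  shows "sym_diff A {a, b} \<in> parity_lift M"
proof -
  have "sym_diff A {a, b} - {0} = sym_diff (A - {0}) ({a, b} - {0})"
    by blast
  moreover have "even (card (sym_diff A {a, b}))"
    using assms by (subst even_card_sym_diff) (auto simp: parity_lift_def)
  ultimately show ?thesis
    using assms(4) by (simp add: parity_lift_def)
qed

text \<open>Exchange at 0 amounts to a single flip in \<open>M\<close> across an odd distance.
  Elsewhere ordinary exchange in \<open>M\<close> suffices unless it flips \<open>a\<close> alone,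
  in which case a second element must be found.\<close>

lemma even_exchange_parity_lift:
  assumes M: "peerless M" and fin: "\<And>A. A \<in> M \<Longrightarrow> finite A"
  shows "even_exchange (parity_lift M)"
  unfolding even_exchange_def
proof (intro ballI)
  fix A B a
  assume A: "A \<in> parity_lift M" and B: "B \<in> parity_lift M" and a: "a \<in> sym_diff A B"
  define A0 where "A0 = A - {0}"
  define B0 where "B0 = B - {0}"
  have M0: "A0 \<in> M" "B0 \<in> M"
    using A B by (auto simp: A0_def B0_def parity_lift_def)
  then have fin0: "finite A0" "finite B0"
    using fin by auto
  then have finAB: "finite A" "finite B"
    by (auto simp: A0_def B0_def)
  have ev: "even (card (sym_diff A B))"
    using A B finAB by (subst even_card_sym_diff) (auto simp: parity_lift_def)
  have D0: "sym_diff A0 B0 = sym_diff A B - {0}"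
    by (auto simp: A0_def B0_def)
  have flip: "\<exists>b\<in>sym_diff A B. b \<noteq> a \<and> sym_diff A {a, b} \<in> parity_lift M"
    if "b \<in> sym_diff A B" "b \<noteq> a" "sym_diff A0 ({a, b} - {0}) \<in> M" for b
    using parity_lift_flip[OF A finAB(1), of a b] that unfolding A0_def by metis
  show "\<exists>b\<in>sym_diff A B. b \<noteq> a \<and> sym_diff A {a, b} \<in> parity_lift M"
  proof (cases "a = 0")
    case True
    have "odd (card (sym_diff A0 B0))"
      using ev a finAB card_Suc_Diff1[of "sym_diff A B" 0] unfolding D0 True by (metis even_Suc finite_Diff finite_Un)
    then obtain b where b: "b \<in> sym_diff A0 B0" "sym_diff A0 {b} \<in> M"
      using peerless_odd_exchange[OF M M0] by blast
    then have "b \<in> sym_diff A B" "b \<noteq> 0"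
      unfolding D0 by auto
    moreover from this have "{a, b} - {0} = {b}"
      using True by auto
    ultimately show ?thesis using flip[of b] b(2) True by simp
  next
    case False
    then have a0: "a \<in> sym_diff A0 B0"
      using a unfolding D0 by blast
    then obtain b where b: "b \<in> sym_diff A0 B0" "sym_diff A0 {a, b} \<in> M"
      using peerless_exchange[OF M M0 _ a0] fin0 by auto
    then have b': "b \<in> sym_diff A B" "b \<noteq> 0"
      unfolding D0 by auto
    show ?thesis
    proof (cases "b = a")
      case False
      moreover have "{a, b} - {0} = {a, b}"
        using \<open>a \<noteq> 0\<close> b' by auto
      ultimately show ?thesis using flip[of b] b b' by metis
    next
      case True
      \<comment> \<open>The lift needs a partner other than \<open>a\<close>: 0 if it lies in the
        difference, otherwise a second single flip.\<close>
      then have aM: "sym_diff A0 {a} \<in> M"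
        using b(2) by simp
      show ?thesis
      proof (cases "0 \<in> sym_diff A B")
        case True
        moreover have "{a, 0} - {0} = {a}"
          using \<open>a \<noteq> 0\<close> by auto
        ultimately show ?thesis using flip[of 0] aM \<open>a \<noteq> 0\<close> by metis
      next
        case False
        then have eq: "sym_diff A0 B0 = sym_diff A B"
          unfolding D0 by blast
        \<comment> \<open>After \<open>a\<close> is flipped, the distance to \<open>B0\<close> is
          odd and \<open>a\<close> is no longer in the difference, so odd exchange gives a partner
          distinct from \<open>a\<close>.\<close>
        have eq': "sym_diff (sym_diff A0 {a}) B0 = sym_diff A B - {a}"
          using a0 unfolding eq[symmetric] by blast
        have "odd (card (sym_diff A B - {a}))"
          using ev a finAB card_Suc_Diff1[of "sym_diff A B" a] by (metis even_Suc finite_Diff finite_Un)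
        then obtain c where c: "c \<in> sym_diff A B - {a}" "sym_diff (sym_diff A0 {a}) {c} \<in> M"
          using peerless_odd_exchange[OF M aM M0(2)] unfolding eq' by blast
        have "c \<noteq> 0"
        proof
          assume "c = 0"
          then show False using c(1) False by simp
        qed
        then have "sym_diff (sym_diff A0 {a}) {c} = sym_diff A0 ({a, c} - {0})"
          using c(1) \<open>a \<noteq> 0\<close> by auto
        then show ?thesis using flip[of c] c by (metis DiffE singletonI)
      qed
    qed
  qed
qed

text \<open>Simultaneous exchange between the lifts of \<open>A\<close> and \<open>B\<close> becomes
  strong exchange once 0 is deleted.\<close>

lemma peerless_strong_exchange:
  fixes M :: "nat set set"
  assumes M: "peerless M" and fin: "\<And>A. A \<in> M \<Longrightarrow> finite A" and zero: "\<And>A. A \<in> M \<Longrightarrow> 0 \<notin> A"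
    and A: "A \<in> M" and B: "B \<in> M" and "A \<noteq> B"
  shows "\<exists>a\<in>sym_diff A B. \<exists>b\<in>sym_diff A B. sym_diff A {a, b} \<in> M \<and> sym_diff B {a, b} \<in> M"
proof -
  define l :: "nat set \<Rightarrow> nat set" where "l X = (if even (card X) then X else insert 0 X)" for X
  have l0: "l X - {0} = X" if "X \<in> M" for X
    using zero[OF that] by (auto simp: l_def)
  have l: "l X \<in> parity_lift M" if "X \<in> M" for X
    using that l0[OF that] zero[OF that] fin[OF that] by (auto simp: parity_lift_def l_def)
  have finl: "finite (l X)" if "X \<in> M" for X
    using fin[OF that] by (auto simp: l_def)
  have D: "sym_diff (l A) (l B) - {0} = sym_diff A B"
    using l0[OF A] l0[OF B] by blast
  then obtain a where a: "a \<in> sym_diff (l A) (l B)"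
    using \<open>A \<noteq> B\<close> by blast
  obtain b where b: "b \<in> sym_diff (l A) (l B)" "b \<noteq> a"
      "sym_diff (l A) {a, b} \<in> parity_lift M" "sym_diff (l B) {a, b} \<in> parity_lift M"
    using even_exchange_simultaneous[OF even_exchange_parity_lift[OF M fin] l[OF A] l[OF B] _ a]
      finl[OF A] finl[OF B] by blast
  have strip: "sym_diff X ({a, b} - {0}) \<in> M" if "X \<in> M" "sym_diff (l X) {a, b} \<in> parity_lift M" for X
  proof -
    have "sym_diff (l X) {a, b} - {0} = sym_diff X ({a, b} - {0})"
      using l0[OF that(1)] by blast
    then show ?thesis using that(2) by (simp add: parity_lift_def)
  qed
  \<comment> \<open>If 0 is one of \<open>a\<close>, \<open>b\<close>, a singleton remains and
    \<open>x = y\<close>: this is where strong exchange uses equal elements.\<close>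
  have "\<exists>x y. {a, b} - {0} = {x, y}"
    using b(2) by (cases "a = 0"; cases "b = 0") (auto simp: insert_Diff_if)
  then obtain x y where xy: "{a, b} - {0} = {x, y}" by blast
  have "{a, b} - {0} \<subseteq> sym_diff (l A) (l B) - {0}"
    using a b(1) by blast
  then have "{x, y} \<subseteq> sym_diff A B"
    unfolding xy D .
  then show ?thesis
    using strip[OF A b(3)] strip[OF B b(4)] unfolding xy by blast
qed

section \<open>Antipode equations\<close>

text \<open>For \<open>S = T\<close> the exponent is 2, so positivity treats both cases
  alike.\<close>

lemma lookup_indet_add_pos: "Poly_Mapping.lookup (indet S + indet T) x > 0 \<longleftrightarrow> x = S \<or> x = T"
  by (auto simp: indet_def lookup_add lookup_single when_def)

text \<open>Two antipodal pairs sharing a vertex coincide up to order, and pairs without a common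
  vertex have different monomials. Hence a second monomial is the same as a pair whose first entry
  is neither \<open>S\<close> nor \<open>T\<close>.\<close>

lemma satisfies_antipode_equation_iff:
  "satisfies (nu M) (antipode_equation I J) \<longleftrightarrow>
     (\<forall>(S, T)\<in>antipodes I J. S \<in> M \<longrightarrow> T \<in> M \<longrightarrow>
        (\<exists>(S', T')\<in>antipodes I J. S' \<in> M \<and> T' \<in> M \<and> S' \<noteq> S \<and> S' \<noteq> T))"
proof -
  define F where "F = {indet S + indet T | S T. (S, T) \<in> antipodes I J \<and> S \<in> M \<and> T \<in> M}"
  have F: "{a \<in> antipode_equation I J. \<forall>x. Poly_Mapping.lookup a x > 0 \<longrightarrow> nu M x} = F"
  proof (rule set_eqI)
    fix m
    have "(\<forall>x. Poly_Mapping.lookup m x > 0 \<longrightarrow> nu M x) \<longleftrightarrow> S \<in> M \<and> T \<in> M"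
      if "m = indet S + indet T" for S T
      unfolding that lookup_indet_add_pos nu_def by blast
    then show "m \<in> {a \<in> antipode_equation I J. \<forall>x. Poly_Mapping.lookup a x > 0 \<longrightarrow> nu M x} \<longleftrightarrow> m \<in> F"
      unfolding antipode_equation_def F_def by blast
  qed
  \<comment> \<open>Cardinality 1 means being a singleton even when \<open>F\<close> is infinite,
    since its cardinality is then 0.\<close>
  have sat: "satisfies (nu M) (antipode_equation I J) \<longleftrightarrow> \<not> (\<exists>m. F = {m})"
    unfolding satisfies_def F by (simp add: card_1_singleton_iff)
  have same: "indet S' + indet T' = indet S + indet T"
    if "(S, T) \<in> antipodes I J" "(S', T') \<in> antipodes I J" "S' = S \<or> S' = T" for S T S' T'
  proof -
    have "sym_diff S' T' = sym_diff S T"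
      using that(1,2) by (simp add: antipodes_def)
    then have "x \<in> sym_diff S' T' \<longleftrightarrow> x \<in> sym_diff S T" for x
      by (rule eqset_imp_iff)
    then have "S' = S \<and> T' = T \<or> S' = T \<and> T' = S"
      using that(3) by blast
    then show ?thesis by (auto simp: add.commute)
  qed
  have diff: "indet S' + indet T' \<noteq> indet S + indet T" if "S' \<noteq> S" "S' \<noteq> T" for S T S' T' :: "nat set"
    using that lookup_indet_add_pos[of S' T' S'] lookup_indet_add_pos[of S T S'] by metis
  show ?thesis
  proof
    assume "satisfies (nu M) (antipode_equation I J)"
    then have notsing: "F \<noteq> {m}" for m
      unfolding sat by blast
    have "\<exists>(S', T')\<in>antipodes I J. S' \<in> M \<and> T' \<in> M \<and> S' \<noteq> S \<and> S' \<noteq> T"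
      if ST: "(S, T) \<in> antipodes I J" "S \<in> M" "T \<in> M" for S T
    proof -
      have "indet S + indet T \<in> F"
        using ST unfolding F_def by blast
      then obtain m where "m \<in> F" "m \<noteq> indet S + indet T"
        using notsing by blast
      then obtain S' T' where "(S', T') \<in> antipodes I J" "S' \<in> M" "T' \<in> M"
          "indet S' + indet T' \<noteq> indet S + indet T"
        unfolding F_def by blast
      then show ?thesis using same[OF ST(1)] by blast
    qed
    then show "\<forall>(S, T)\<in>antipodes I J. S \<in> M \<longrightarrow> T \<in> M \<longrightarrow>
        (\<exists>(S', T')\<in>antipodes I J. S' \<in> M \<and> T' \<in> M \<and> S' \<noteq> S \<and> S' \<noteq> T)"
      by blast
  next
    assume R: "\<forall>(S, T)\<in>antipodes I J. S \<in> M \<longrightarrow> T \<in> M \<longrightarrow>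
        (\<exists>(S', T')\<in>antipodes I J. S' \<in> M \<and> T' \<in> M \<and> S' \<noteq> S \<and> S' \<noteq> T)"
    show "satisfies (nu M) (antipode_equation I J)"
      unfolding sat
    proof
      assume "\<exists>m. F = {m}"
      then obtain m where m: "F = {m}" by blast
      then obtain S T where ST: "m = indet S + indet T" "(S, T) \<in> antipodes I J" "S \<in> M" "T \<in> M"
        unfolding F_def by blast
      then obtain S' T' where S': "(S', T') \<in> antipodes I J" "S' \<in> M" "T' \<in> M" "S' \<noteq> S" "S' \<noteq> T"
        using bspec[OF R ST(2)] ST(3,4) by blast
      then have "indet S' + indet T' \<in> F"
        unfolding F_def by blast
      then show False using diff[OF S'(4,5)] unfolding m ST(1) by simp
    qed
  qed
qed

text \<open>Any antipodal pair of a cube spans that same cube. Thus the equation of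
  \<open>I, J\<close> only constrains antipodal pairs inside \<open>M\<close>, and those may be
  taken as the spanning sets.\<close>

lemma peerless_antipode_equations_iff:
  assumes "set_system n M"
  shows "(\<forall>f\<in>peerless_antipode_equations n. satisfies (nu M) f) \<longleftrightarrow> peerless M"
proof -
  have "(\<forall>f\<in>peerless_antipode_equations n. satisfies (nu M) f) \<longleftrightarrow>
      (\<forall>I J. I \<subseteq> {1..n} \<longrightarrow> J \<subseteq> {1..n} \<longrightarrow> card (sym_diff I J) \<ge> 3 \<longrightarrow>
         satisfies (nu M) (antipode_equation I J))"
    unfolding peerless_antipode_equations_def by blast
  also have "\<dots> \<longleftrightarrow> peerless M"
  proof
    assume L: "\<forall>I J. I \<subseteq> {1..n} \<longrightarrow> J \<subseteq> {1..n} \<longrightarrow> card (sym_diff I J) \<ge> 3 \<longrightarrow>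
        satisfies (nu M) (antipode_equation I J)"
    show "peerless M"
      unfolding peerless_def
    proof (intro ballI impI)
      fix A B assume AB: "A \<in> M" "B \<in> M" "card (sym_diff A B) \<ge> 3"
      then have "satisfies (nu M) (antipode_equation A B)"
        using L assms unfolding set_system_def by blast
      then have "\<exists>(S, T)\<in>antipodes A B. S \<in> M \<and> T \<in> M \<and> S \<noteq> A \<and> S \<noteq> B"
        using AB unfolding satisfies_antipode_equation_iff by (auto simp: antipodes_def)
      then show "\<exists>S\<in>M. \<exists>T\<in>M. S \<inter> T = A \<inter> B \<and> sym_diff S T = sym_diff A B \<and> S \<noteq> A \<and> S \<noteq> B"
        unfolding antipodes_def by blast
    qed
  next
    assume M: "peerless M"
    show "\<forall>I J. I \<subseteq> {1..n} \<longrightarrow> J \<subseteq> {1..n} \<longrightarrow> card (sym_diff I J) \<ge> 3 \<longrightarrow>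
        satisfies (nu M) (antipode_equation I J)"
    proof (intro allI impI)
      fix I J :: "nat set" assume c: "card (sym_diff I J) \<ge> 3"
      have "\<exists>(S', T')\<in>antipodes I J. S' \<in> M \<and> T' \<in> M \<and> S' \<noteq> S \<and> S' \<noteq> T"
        if "(S, T) \<in> antipodes I J" "S \<in> M" "T \<in> M" for S T
      proof -
        have eq: "S \<inter> T = I \<inter> J" "sym_diff S T = sym_diff I J"
          using that(1) unfolding antipodes_def by auto
        then have "\<exists>S'\<in>M. \<exists>T'\<in>M. S' \<inter> T' = I \<inter> J \<and> sym_diff S' T' = sym_diff I J \<and> S' \<noteq> S \<and> S' \<noteq> T"
          using M that(2,3) c unfolding peerless_def by metis
        then show ?thesis unfolding antipodes_def by blast
      qed
      then show "satisfies (nu M) (antipode_equation I J)"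
        unfolding satisfies_antipode_equation_iff by blast
    qed
  qed
  finally show ?thesis .
qed

section \<open>Peerless systems and strong \<Delta>-matroids\<close>

text \<open>Flipping \<open>{a, b}\<close> in both \<open>A\<close> and \<open>B\<close> gives
  another antipodal pair of the same cube. It is a new pair because the difference has at least 3
  elements, more than \<open>{a, b}\<close>.\<close>

lemma strong_delta_matroid_imp_peerless:
  assumes "strong_delta_matroid n M"
  shows "peerless M"
  unfolding peerless_def
proof (intro ballI impI)
  fix A B assume AB: "A \<in> M" "B \<in> M" "card (sym_diff A B) \<ge> 3"
  then have "A \<noteq> B" by auto
  then obtain a b where ab: "a \<in> sym_diff A B" "b \<in> sym_diff A B"
      "sym_diff A {a, b} \<in> M" "sym_diff B {a, b} \<in> M"
    using assms AB unfolding strong_delta_matroid_def by blast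
  have "card {a, b} \<le> 2"
    by (simp add: card_insert_if)
  then have "sym_diff A B \<noteq> {a, b}"
    using AB(3) by auto
  then have "sym_diff A {a, b} \<noteq> B"
    using ab(1,2) by blast
  moreover have "sym_diff A {a, b} \<noteq> A"
    by blast
  moreover have "sym_diff A {a, b} \<inter> sym_diff B {a, b} = A \<inter> B"
    using ab(1,2) by blast
  moreover have "sym_diff (sym_diff A {a, b}) (sym_diff B {a, b}) = sym_diff A B"
    by blast
  ultimately show "\<exists>S\<in>M. \<exists>T\<in>M. S \<inter> T = A \<inter> B \<and> sym_diff S T = sym_diff A B \<and> S \<noteq> A \<and> S \<noteq> B"
    using ab(3,4) by blast
qed

text \<open>Members of \<open>M\<close> are finite and avoid 0, so the parity lift applies and gives
  the strong axiom; the plain exchange axiom comes directly from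
  \<open>peerless_exchange\<close>.\<close>

lemma peerless_imp_strong_delta_matroid:
  assumes M: "set_system n M" and P: "peerless M"
  shows "strong_delta_matroid n M"
proof -
  have fin: "finite A" and zero: "0 \<notin> A" if "A \<in> M" for A
  proof -
    have "A \<subseteq> {1..n}"
      using M that unfolding set_system_def by blast
    then show "finite A" "0 \<notin> A"
      using finite_subset by auto
  qed
  have "\<exists>b\<in>sym_diff A B. sym_diff A {a, b} \<in> M"
    if "A \<in> M" "B \<in> M" "a \<in> sym_diff A B" for A B a
    using peerless_exchange[OF P that(1,2) _ that(3)] fin that(1,2) by blast
  then show ?thesis
    using peerless_strong_exchange[OF P fin zero] M
    unfolding strong_delta_matroid_def delta_matroid_def by blast
qed

theorem corollary4p2:
  fixes n :: nat and M :: "nat set set"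
  assumes "set_system n M"
  shows "strong_delta_matroid n M \<longleftrightarrow>
           (\<forall>f \<in> peerless_antipode_equations n. satisfies (nu M) f)"
  using assms peerless_antipode_equations_iff strong_delta_matroid_imp_peerless
    peerless_imp_strong_delta_matroid by blast

end
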